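(* Let $F$ be a field of characteristic not $2$ and let $R$ be a unital commutative associative $F$-algebra which is an integral domain. Let $(X,H,Y)$ be an $s\ell_2$-triple with $X,H,Y\in\mathfrak{sl}_2(R)$. Then there is an automorphism $\tau\in \mathrm{Aut}_F(\mathfrak{sl}_2(R))$ satisfying $$\tau(X)=\begin{pmatrix}0&1\\0&0\end{pmatrix},\qquad \tau(H)=\begin{pmatrix}1&0\\0&-1\end{pmatrix},\qquad \tau(Y)=\begin{pmatrix}0&0\\1&0\end{pmatrix}.$$ Furthermore, if $R$ is a unique factorization domain, then $\tau$ can be chosen to be in $PGL_2(R)\subset \mathrm{Aut}_F(\mathfrak{sl}_2(R))$.
   Context: $\mathfrak{sl}_2(R)$ denotes the set of $2\times 2$ matrices $\begin{pmatrix}a&b\\c&-a\end{pmatrix}$ with $a,b,c\in R$, viewed as a Lie algebra over $F$ under the commutator bracket; $\mathrm{Aut}_F(\mathfrak{sl}_2(R))$ is its group of $F$-Lie algebra automorphisms. A triple $(e,h,f)$ of nonzero elements of a Lie algebra is called an $s\ell_2$-triple if $[h,e]=2e$, $[h,f]=-2f$, $[e,f]=h$. $GL_2(R)$ is the group of $2\times 2$ matrices over $R$ whose determinant is a unit of $R$, and $PGL_2(R)$ is its quotient by its center $\{uI\mid u\in R^\times\}$; $PGL_2(R)$ is regarded as the subgroup of $\mathrm{Aut}_F(\mathfrak{sl}_2(R))$ consisting of the conjugations $Z\mapsto PZP^{-1}$ with $P\in GL_2(R)$. *)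

theory Defs
  imports "HOL-Analysis.Determinants" "HOL-Algebra.Algebraic_Closure_Type"
begin

unbundle no Formal_Power_Series.fps_syntax

locale comm_unital_algebra = vector_space scal
  for scal :: "'f::field \<Rightarrow> 'r::comm_ring_1 \<Rightarrow> 'r" +
  assumes scale_mult_left: "scal c (x * y) = scal c x * y"

text \<open>
  The bridge \<open>ring_of_type_algebra\<close> turns the ring type \<open>'r\<close> into a ring record with carrier
  \<open>UNIV\<close>, so that being factorial becomes a predicate on \<open>'r\<close> rather than a type class (the class
  \<open>factorial_semiring\<close> would in addition fix a normalization function).
\<close>
definition unique_factorization_domain :: "'r::idom itself \<Rightarrow> bool" where
  "unique_factorization_domain _ \<longleftrightarrow> factorial_domain (ring_of_type_algebra :: 'r ring)"

definition mat2 :: "'r \<Rightarrow> 'r \<Rightarrow> 'r \<Rightarrow> 'r \<Rightarrow> 'r::zero^2^2" where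
  "mat2 a b c d = vector [vector [a, b], vector [c, d]]"

definition mat_scale :: "('f \<Rightarrow> 'r \<Rightarrow> 'r) \<Rightarrow> 'f \<Rightarrow> 'r^'n^'m \<Rightarrow> 'r^'n^'m" where
  "mat_scale scal c A = (\<chi> i j. scal c (A $ i $ j))"

definition commutator :: "'r::comm_ring_1^'n^'n \<Rightarrow> 'r^'n^'n \<Rightarrow> 'r^'n^'n" where
  "commutator A B = A ** B - B ** A"

definition sl2 :: "('r::comm_ring_1^2^2) set" where
  "sl2 = {mat2 a b c (- a) | a b c. True}"

definition GL2 :: "('r::comm_ring_1^2^2) set" where
  "GL2 = {P. det P dvd 1}"

definition sl2_triple ::
    "('f::field \<Rightarrow> 'v \<Rightarrow> 'v) \<Rightarrow> ('v \<Rightarrow> 'v \<Rightarrow> 'v) \<Rightarrow> 'v \<Rightarrow> 'v \<Rightarrow> 'v::ab_group_add \<Rightarrow> bool" where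
  "sl2_triple smul bracket e h f \<longleftrightarrow>
     e \<noteq> 0 \<and> h \<noteq> 0 \<and> f \<noteq> 0 \<and>
     bracket h e = smul 2 e \<and> bracket h f = smul (- 2) f \<and> bracket e f = h"

text \<open>
  Automorphisms of a Lie algebra with carrier \<open>L\<close>, scalar multiplication \<open>smul\<close> and the given
  bracket. Maps out of \<open>L\<close> are represented by functions that are \<open>undefined\<close> outside \<open>L\<close>.
\<close>
definition lie_automorphisms ::
    "('f::field \<Rightarrow> 'v \<Rightarrow> 'v) \<Rightarrow> ('v \<Rightarrow> 'v \<Rightarrow> 'v) \<Rightarrow> 'v::ab_group_add set \<Rightarrow> ('v \<Rightarrow> 'v) set" where
  "lie_automorphisms smul bracket L =
     {\<tau> \<in> extensional L. bij_betw \<tau> L L \<and>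
        (\<forall>x\<in>L. \<forall>y\<in>L. \<tau> (x + y) = \<tau> x + \<tau> y) \<and>
        (\<forall>c. \<forall>x\<in>L. \<tau> (smul c x) = smul c (\<tau> x)) \<and>
        (\<forall>x\<in>L. \<forall>y\<in>L. \<tau> (bracket x y) = bracket (\<tau> x) (\<tau> y))}"

abbreviation Aut_sl2 :: "('f::field \<Rightarrow> 'r \<Rightarrow> 'r) \<Rightarrow> ('r::comm_ring_1^2^2 \<Rightarrow> 'r^2^2) set" where
  "Aut_sl2 scal \<equiv> lie_automorphisms (mat_scale scal) commutator sl2"

text \<open>
  \<open>PGL\<^sub>2(R)\<close> in its realization by conjugations: scalar matrices act trivially, and two elements of
  \<open>GL\<^sub>2(R)\<close> give the same map on \<open>sl\<^sub>2(R)\<close> iff they differ by a unit scalar.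
\<close>
definition PGL2 :: "('r::comm_ring_1^2^2 \<Rightarrow> 'r^2^2) set" where
  "PGL2 = {restrict (\<lambda>Z. P ** Z ** matrix_inv P) sl2 | P. P \<in> GL2}"

lemma mat2_nth [simp]:
  "mat2 a b c d $ 1 $ 1 = a" "mat2 a b c d $ 1 $ 2 = b"
  "mat2 a b c d $ 2 $ 1 = c" "mat2 a b c d $ 2 $ 2 = d"
  by (simp_all add: mat2_def)

lemma mat2_eq_iff:
  "A = B \<longleftrightarrow> A$1$1 = B$1$1 \<and> A$1$2 = B$1$2 \<and> A$2$1 = B$2$1 \<and> A$2$2 = B$2$2"
  for A B :: "'r^2^2"
  by (auto simp: vec_eq_iff forall_2)

lemma sl2_iff: "Z \<in> sl2 \<longleftrightarrow> Z$2$2 = - Z$1$1"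
  unfolding sl2_def mat2_eq_iff by auto

lemma mat2_mult_nth: "((A :: 'r::comm_ring_1^2^2) ** B) $ i $ j = A$i$1 * B$1$j + A$i$2 * B$2$j"
  by (simp add: matrix_matrix_mult_def sum_2)

lemma GL2_matrix_inv:
  fixes P :: "'r::comm_ring_1^2^2"
  assumes "P \<in> GL2"
  shows "P ** matrix_inv P = mat 1" and "matrix_inv P ** P = mat 1"
proof -
  from assms obtain u where u: "1 = det P * u"
    unfolding GL2_def dvd_def by blast
  then have u': "P$1$1 * P$2$2 * u = 1 + P$1$2 * P$2$1 * u"
    by (simp add: det_2 algebra_simps)
  let ?Q = "mat2 (u * P$2$2) (- (u * P$1$2)) (- (u * P$2$1)) (u * P$1$1)"
  have "P ** ?Q = mat 1" "?Q ** P = mat 1"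
    using u' by (simp_all add: mat2_eq_iff mat2_mult_nth mat_def algebra_simps)
  then have "P ** matrix_inv P = mat 1 \<and> matrix_inv P ** P = mat 1"
    unfolding matrix_inv_def
    using someI[of "\<lambda>Q. P ** Q = mat 1 \<and> Q ** P = mat 1" ?Q] by simp
  then show "P ** matrix_inv P = mat 1" "matrix_inv P ** P = mat 1" by auto
qed

lemma conj_mem_sl2:
  fixes P Q Z :: "'r::comm_ring_1^2^2"
  assumes QP: "Q ** P = mat 1" and Z: "Z \<in> sl2"
  shows "P ** Z ** Q \<in> sl2"
proof -
  have "trace (P ** Z ** Q) = trace (Q ** (P ** Z))" by (rule trace_mul_sym)
  also have "\<dots> = trace Z" by (simp add: matrix_mul_assoc QP)
  finally show ?thesis using Z by (simp add: trace_def sum_2 sl2_iff eq_neg_iff_add_eq_0 add.commute)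
qed

lemma (in comm_unital_algebra) scale_mult_right: "scal c (x * y) = x * scal c y"
  using scale_mult_left[of c y x] by (simp add: mult.commute)

text \<open>The inclusion of \<open>PGL\<^sub>2(R)\<close> in the automorphism group.\<close>

lemma (in comm_unital_algebra) PGL2_subset_Aut: "PGL2 \<subseteq> Aut_sl2 scal"
proof
  fix \<tau> :: "'r^2^2 \<Rightarrow> 'r^2^2"
  assume "\<tau> \<in> PGL2"
  then obtain P where P: "P \<in> GL2" and \<tau>: "\<tau> = restrict (\<lambda>Z. P ** Z ** matrix_inv P) sl2"
    unfolding PGL2_def by blast
  define Q where "Q = matrix_inv P"
  note PQ = GL2_matrix_inv[OF P, folded Q_def]
  have eq: "\<tau> Z = P ** Z ** Q" if "Z \<in> sl2" for Z
    using that by (simp add: \<tau> Q_def)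
  have m: "P ** Z ** Q \<in> sl2" "Q ** Z ** P \<in> sl2" if "Z \<in> sl2" for Z
    using conj_mem_sl2 PQ that by blast+
  have c1: "Q ** (P ** Z ** Q) ** P = Z" for Z
    by (metis PQ(2) matrix_mul_assoc matrix_mul_lid matrix_mul_rid)
  have c2: "P ** (Q ** Z ** P) ** Q = Z" for Z
    by (metis PQ(1) matrix_mul_assoc matrix_mul_lid matrix_mul_rid)
  have bij: "bij_betw \<tau> sl2 sl2"
    by (rule bij_betw_byWitness[where f' = "\<lambda>Z. Q ** Z ** P"]) (auto simp: eq m c1 c2)
  have add: "\<tau> (x + y) = \<tau> x + \<tau> y" if "x \<in> sl2" "y \<in> sl2" for x y
  proof -
    have "x + y \<in> sl2" using that by (simp add: sl2_iff)
    then show ?thesis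
      using that by (simp add: eq mat2_eq_iff mat2_mult_nth algebra_simps)
  qed
  have sc: "\<tau> (mat_scale scal c x) = mat_scale scal c (\<tau> x)" if "x \<in> sl2" for c x
  proof -
    have "mat_scale scal c x \<in> sl2" using that by (simp add: sl2_iff mat_scale_def)
    moreover have "mat_scale scal c A ** B = mat_scale scal c (A ** B)"
      "A ** mat_scale scal c B = mat_scale scal c (A ** B)" for A B :: "'r^2^2"
      by (simp_all add: mat2_eq_iff mat2_mult_nth mat_scale_def scale_right_distrib
          scale_mult_left[symmetric] scale_mult_right[symmetric])
    ultimately show ?thesis
      using that by (simp add: eq)
  qed
  have br: "\<tau> (commutator x y) = commutator (\<tau> x) (\<tau> y)" if "x \<in> sl2" "y \<in> sl2" for x y
  proof -
    have "commutator x y \<in> sl2" by (simp add: sl2_iff commutator_def mat2_mult_nth algebra_simps)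
    moreover have "P ** A ** Q ** (P ** B ** Q) = P ** (A ** B) ** Q" for A B
      by (metis PQ(2) matrix_mul_assoc matrix_mul_rid)
    moreover have "P ** (A - B) ** Q = P ** A ** Q - P ** B ** Q" for A B
      by (simp add: mat2_eq_iff mat2_mult_nth algebra_simps)
    ultimately show ?thesis
      using that by (simp add: eq commutator_def)
  qed
  show "\<tau> \<in> Aut_sl2 scal"
    unfolding lie_automorphisms_def using bij add sc br by (auto simp: \<tau>)
qed

end

theory Submission
  imports Defs
begin

text \<open>
  The relations of an $s\ell_2$-triple of traceless $2 \times 2$ matrices over a domain with $1/2$
  force associative identities. Since $AB + BA$ is the scalar matrix $\mathrm{tr}(AB)$ for traceless
  $A$, $B$, and $\mathrm{tr}(h[h,x]) = 0$ gives $\mathrm{tr}(hx) = 0$, the matrices $h$ and $x$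
  anticommute, so $[h,x] = 2x$ becomes $hx = x = -xh$; likewise $hy = -y = -yh$. Hence
  $x^2 = y^2 = 0$, and multiplying the scalar matrix $xy + yx$ by $h$ yields $xy - yx = h$, so that
  $xy + yx = 1$ and $h^2 = 1$ (\<open>x_y_mult\<close>). These arguments divide by nothing but $2$, so
  characteristic $3$ needs no separate treatment.

  Consequently the trace form has the same Gram matrix on $(x,h,y)$ as on the standard triple, and
  by the identities above no nonzero traceless matrix is orthogonal to all three
  (\<open>trace_form_nondegenerate\<close>). So $(x,h,y)$ is an $R$-basis of $sl_2(R)$ with coordinates
  $Z \mapsto (\mathrm{tr}(Zy), \frac12 \mathrm{tr}(Zh), \mathrm{tr}(Zx))$. Sending this basis to the
  standard one respects brackets because both bases have the same structure constants, which gives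
  the automorphism \<open>to_standard\<close>.

  Over a unique factorization domain the conjugating matrix comes from a kernel vector of $x$. Write
  $x$ with rows $(a, b)$ and $(c, -a)$. From $x^2 = 0$ one has $b(-c) = a^2$, and
  $\mathrm{tr}(xy) = 1$ makes $b$ and $c$ coprime; so $b = us^2$, $-c = ut^2$, $a = ust$ with a
  unit $u$ (\<open>coprime_factors_of_square\<close>). Then $v = (s, -t)$ satisfies $xv = 0$, and the matrix $Q$
  with columns $v$ and $yv$ has $u \det Q = \mathrm{tr}(xy) = 1$. As $x(yv) = (1 - yx)v = v$
  and $y(yv) = 0$, conjugation by $Q^{-1}$ takes the triple to the standard one.
\<close>

section \<open>Coprime factors of a square\<close>

text \<open>
  Factoriality is given for the multiplicative monoid of nonzero elements; this restates it with the
  divisibility notions of the ring type. Irreducibles are replaced by primes, which is what the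
  divisibility arguments below consume.
\<close>

lemma unique_factorization_primes:
  fixes b :: "'r::idom"
  assumes "unique_factorization_domain TYPE('r)" and "b \<noteq> 0"
  obtains u ps where "u dvd 1" "\<And>p. p \<in> set ps \<Longrightarrow> prime_elem p" "b = u * prod_list ps"
proof -
  define R where "R = (ring_of_type_algebra :: 'r ring)"
  define M where "M = Ring_Divisibility.mult_of R"
  interpret M: factorial_monoid M
    using assms(1) unfolding unique_factorization_domain_def factorial_domain_def M_def R_def by simp
  have M [simp]: "carrier M = - {0}" "x \<otimes>\<^bsub>M\<^esub> y = x * y" "\<one>\<^bsub>M\<^esub> = 1" for x y
    by (auto simp: M_def R_def ring_of_type_algebra_def)
  have Units: "u \<in> Units M \<longleftrightarrow> u dvd 1" for u
    by (auto simp: Units_def dvd_def mult.commute)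
  have divides: "x divides\<^bsub>M\<^esub> y \<longleftrightarrow> x dvd y" if "y \<noteq> 0" for x y
    using that by (auto simp: factor_def dvd_def)
  have prime: "prime_elem p" if "Divisibility.irreducible M p" "p \<noteq> 0" for p
  proof -
    have "Divisibility.prime M p" using M.irreducible_prime that by simp
    then have notunit: "\<not> p dvd 1"
      and dv: "\<And>a b. a \<noteq> 0 \<Longrightarrow> b \<noteq> 0 \<Longrightarrow> p dvd a * b \<Longrightarrow> p dvd a \<or> p dvd b"
      by (auto simp: Divisibility.prime_def Units divides)
    then have "p dvd a \<or> p dvd b" if "p dvd a * b" for a b
      using that by (cases "a = 0 \<or> b = 0") auto
    with notunit show ?thesis using that by (auto simp: prime_elem_def)
  qed
  have foldr: "foldr (\<otimes>\<^bsub>M\<^esub>) ps 1 = prod_list ps" for ps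
    by (induction ps) simp_all
  show thesis
  proof (cases "b dvd 1")
    case True
    then show ?thesis using that[of b "[]"] by simp
  next
    case False
    then obtain ps where "set ps \<subseteq> carrier M" "factors M ps b"
      using M.factors_exist[of b] assms(2) by (auto simp: Units)
    then show ?thesis
      using that[of 1 ps] prime by (auto simp: factors_def foldr)
  qed
qed

text \<open>
  Some factor $q$ is divisible by $p$, and as both are prime they differ by a unit $w$. The unit is
  kept explicit because associates in a domain have no canonical representatives.
\<close>

lemma prime_dvd_prod_list_primes:
  fixes p :: "'r::idom"
  assumes p: "prime_elem p" and "\<And>q. q \<in> set qs \<Longrightarrow> prime_elem q" and "p dvd prod_list qs"
  obtains w rs where "w dvd 1" "set rs \<subseteq> set qs" "length rs < length qs"
    "prod_list qs = p * w * prod_list rs"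
proof -
  have p0: "p \<noteq> 0" and p1: "\<not> p dvd 1" using p by (auto simp: prime_elem_def)
  obtain q where q: "q \<in> set qs" "p dvd q"
    using assms(3) p by (induction qs) (auto dest: prime_elem_dvd_multD simp: prime_elem_def)
  then obtain rs1 rs2 where qs: "qs = rs1 @ q # rs2" by (meson split_list)
  obtain w where w: "q = p * w" using q by blast
  have qp: "prime_elem q" using q assms(2) by simp
  then have "w \<noteq> 0" using w by (auto simp: prime_elem_def)
  have "q dvd p * w" by (simp add: w)
  then have "q dvd p \<or> q dvd w" using qp by (metis prime_elem_dvd_multD)
  moreover have "p dvd 1" if "q dvd w"
  proof -
    from that obtain k where "w = q * k" by blast
    then have k: "w = p * w * k" by (simp only: w)
    have "w * (p * k) = p * w * k" by (simp add: ac_simps)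
    with k have "w * 1 = w * (p * k)" by (metis mult_1_right)
    with \<open>w \<noteq> 0\<close> show ?thesis by (metis dvd_triv_left mult_left_cancel)
  qed
  moreover have "w dvd 1" if "q dvd p"
  proof -
    from that obtain k where "p = q * k" by blast
    then have "p = p * w * k" by (simp only: w)
    then have "p * 1 = p * (w * k)" by (metis mult_1_right mult.assoc)
    with p0 show ?thesis by (metis dvd_triv_left mult_left_cancel)
  qed
  ultimately have "w dvd 1" using p1 by blast
  then show thesis by (rule that[of w "rs1 @ rs2"]) (auto simp: qs w ac_simps)
qed

text \<open>
  Induction on the number of primes in $b$. A prime $p$ of $b$ divides $a$ but not $c$, so $p^2$
  divides $a^2 = bc$ and hence $b$; cancelling $p^2$ leaves an instance with two primes fewer. Carrying
  the representation of $a$ and $c$ along makes it unnecessary to extract a square root of a unit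
  at the end.
\<close>

lemma coprime_factors_of_square_aux:
  fixes a b c u :: "'r::idom"
  assumes "\<And>p. p \<in> set ps \<Longrightarrow> prime_elem p" and "u dvd 1"
    and "b = u * prod_list ps" and "b * c = a\<^sup>2"
    and "\<And>d. d dvd b \<Longrightarrow> d dvd c \<Longrightarrow> d dvd 1"
  shows "\<exists>u s t. u dvd 1 \<and> b = u * s\<^sup>2 \<and> c = u * t\<^sup>2 \<and> a = u * s * t"
  using assms
proof (induction "length ps" arbitrary: ps u a b rule: less_induct)
  case less
  show ?case
  proof (cases "b dvd 1")
    case True
    then obtain v where v: "1 = b * v" by (auto simp: dvd_def)
    have "b * (a * v)\<^sup>2 = (b * v) * (v * a\<^sup>2)" by (simp add: power2_eq_square ac_simps)
    also have "\<dots> = (b * v) * c" using v by (simp add: less.prems(4)[symmetric] ac_simps)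
    finally have "c = b * (a * v)\<^sup>2" using v by simp
    moreover have "a = b * 1 * (a * v)" using v by (metis mult.assoc mult.commute mult_1)
    ultimately show ?thesis by (intro exI[of _ b] exI[of _ 1] exI[of _ "a * v"]) (use True in simp)
  next
    case False
    with less.prems obtain p qs where ps: "ps = p # qs" by (cases ps) auto
    have p: "prime_elem p" using less.prems ps by simp
    then have p0: "p \<noteq> 0" and p1: "\<not> p dvd 1" by (auto simp: prime_elem_def)
    have pb: "p dvd b" using less.prems(3) ps by simp
    then have "p dvd a\<^sup>2" using less.prems(4) by (metis dvd_mult2)
    then have "p dvd a" using p by (metis power2_eq_square prime_elem_dvd_multD)
    then obtain a1 where a1: "a = p * a1" by blast
    have pc: "\<not> p dvd c" using less.prems(5) pb p1 by blast
    define b1 where "b1 = u * prod_list qs"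
    have b1: "b = p * b1" using less.prems(3) ps by (simp add: b1_def)
    have "p * (b1 * c) = p * (p * a1\<^sup>2)"
      using less.prems(4) by (simp add: a1 b1 power2_eq_square ac_simps)
    then have e1: "b1 * c = p * a1\<^sup>2" using p0 by simp
    then have "p dvd b1" using p pc by (metis dvd_triv_left prime_elem_dvd_multD)
    then have "p dvd prod_list qs"
      using p less.prems(2) p1 unfolding b1_def
      by (metis dvd_trans prime_elem_dvd_multD)
    then obtain w rs where w: "w dvd 1" and rs: "set rs \<subseteq> set qs" "length rs < length qs"
      and qs: "prod_list qs = p * w * prod_list rs"
      using prime_dvd_prod_list_primes[OF p, of qs] less.prems(1) ps by auto
    define b2 where "b2 = (u * w) * prod_list rs"
    have b2: "b1 = p * b2" by (simp add: b1_def b2_def qs ac_simps)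
    have "p * (b2 * c) = p * a1\<^sup>2" using e1 b2 by simp
    then have e2: "b2 * c = a1\<^sup>2" using p0 by simp
    have "\<exists>u s t. u dvd 1 \<and> b2 = u * s\<^sup>2 \<and> c = u * t\<^sup>2 \<and> a1 = u * s * t"
    proof (rule less.hyps[OF _ _ _ b2_def e2])
      show "length rs < length ps" using rs by (simp add: ps)
      show "prime_elem r" if "r \<in> set rs" for r
        using that rs less.prems(1) by (auto simp: ps)
      show "u * w dvd 1" using w less.prems(2) by (metis mult_dvd_mono mult_1)
      show "d dvd 1" if "d dvd b2" "d dvd c" for d
        using that less.prems(5) by (simp add: b1 b2)
    qed
    then obtain v s t where v: "v dvd 1" "b2 = v * s\<^sup>2" "c = v * t\<^sup>2" "a1 = v * s * t" by blast
    then have "b = v * (p * s)\<^sup>2" "a = v * (p * s) * t"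
      by (simp_all add: b1 b2 a1 power2_eq_square ac_simps)
    with v show ?thesis by blast
  qed
qed

lemma coprime_factors_of_square:
  fixes a b c :: "'r::idom"
  assumes ufd: "unique_factorization_domain TYPE('r)" and sq: "b * c = a\<^sup>2"
    and cop: "\<And>d. d dvd b \<Longrightarrow> d dvd c \<Longrightarrow> d dvd 1"
  obtains u s t where "u dvd 1" "b = u * s\<^sup>2" "c = u * t\<^sup>2" "a = u * s * t"
proof (cases "b = 0")
  case True
  then have "c dvd 1" "a = 0" using cop[of c] sq by simp_all
  with True show ?thesis using that[of c 0 1] by simp
next
  case False
  then obtain u ps where "u dvd 1" "\<And>p. p \<in> set ps \<Longrightarrow> prime_elem p" "b = u * prod_list ps"
    using unique_factorization_primes[OF ufd] by blast
  from coprime_factors_of_square_aux[OF this(2,1,3) sq cop] that show ?thesis by blast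
qed

section \<open>Two by two matrices\<close>

lemma mat_mult_nth: "(mat c ** (A :: 'r::comm_ring_1^2^2)) $ i $ j = c * A $ i $ j"
  using exhaust_2[of i] by (auto simp: mat2_mult_nth mat_def)

lemma sl2_anticommutator:
  fixes A B :: "'r::comm_ring_1^2^2"
  assumes "A \<in> sl2" "B \<in> sl2"
  shows "A ** B + B ** A = mat (trace (A ** B))"
  using assms by (simp add: mat2_eq_iff mat2_mult_nth mat_def sl2_iff trace_def sum_2 algebra_simps)

lemma mult_mat_eq: "(A :: 'r::comm_ring_1^2^2) ** mat c = mat c ** A"
  by (simp add: mat2_eq_iff mat2_mult_nth mat_def)

lemma matrix_ring_simps:
  fixes A B C :: "'r::comm_ring_1^2^2"
  shows "(A + B) ** C = A ** C + B ** C" "A ** (B + C) = A ** B + A ** C"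
    "(A - B) ** C = A ** C - B ** C" "A ** (B - C) = A ** B - A ** C"
    "(- A) ** C = - (A ** C)" "A ** (- C) = - (A ** C)" "0 ** A = 0" "A ** 0 = 0"
  by (simp_all add: mat2_eq_iff mat2_mult_nth algebra_simps)

section \<open>Triples of traceless matrices\<close>

text \<open>
  The base field enters the triple relations only through the scalars $2$ and $-2$, so they are
  stated over the coefficient ring, where it leaves behind the element $1/2$.
\<close>

locale matrix_sl2_triple =
  fixes x h y :: "'r::idom^2^2" and half :: 'r
  assumes half: "2 * half = 1"
    and sl2: "x \<in> sl2" "h \<in> sl2" "y \<in> sl2"
    and hx: "commutator h x = x + x" and hy: "commutator h y = - (y + y)"
    and xy: "commutator x y = h"
    and h_neq_0: "h \<noteq> 0"
begin

lemma two_neq_0: "(2::'r) \<noteq> 0"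
  using half by auto

lemma double_eq_0: "(A :: 'r^2^2) + A = 0 \<longleftrightarrow> A = 0"
  using two_neq_0 by (simp add: mat2_eq_iff flip: mult_2)

lemma double_eq_iff: "(A :: 'r^2^2) + A = B + B \<longleftrightarrow> A = B"
  using two_neq_0 by (simp add: mat2_eq_iff flip: mult_2)

lemma trace_mult_commutator: "trace (A ** commutator A B) = 0" for A B :: "'r^2^2"
  by (simp add: commutator_def trace_def sum_2 mat2_mult_nth algebra_simps)

lemma trace_hx_hy: "trace (h ** x) = 0" "trace (h ** y) = 0"
proof -
  have "trace (A ** (B + B)) = 2 * trace (A ** B)" "trace (A ** (- B)) = - trace (A ** B)"
    for A B :: "'r^2^2"
    by (simp_all add: trace_def sum_2 mat2_mult_nth algebra_simps)
  then have "2 * trace (h ** x) = 0" "2 * trace (h ** y) = 0"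
    using trace_mult_commutator[of h x] trace_mult_commutator[of h y] by (simp_all add: hx hy)
  then show "trace (h ** x) = 0" "trace (h ** y) = 0"
    using two_neq_0 by simp_all
qed

text \<open>
  The vanishing trace makes $h$ and $A$ anticommute, so $[h,A] = 2hA$: eigenvectors of
  $\mathrm{ad}\,h$ become eigenvectors of multiplication by $h$.
\<close>

lemma h_eigenvector:
  assumes "A \<in> sl2" "trace (h ** A) = 0" "commutator h A = B + B"
  shows "h ** A = B" "A ** h = - B"
proof -
  have "h ** A + A ** h = 0"
    using sl2_anticommutator[OF sl2(2) assms(1)] assms(2) by (simp add: mat2_eq_iff mat_def)
  then have *: "A ** h = - (h ** A)" by (simp add: add_eq_0_iff)
  with assms(3) have "h ** A + h ** A = B + B" by (simp add: commutator_def)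
  then show "h ** A = B" by (simp only: double_eq_iff)
  with * show "A ** h = - B" by simp
qed

lemma h_mult: "h ** x = x" "x ** h = - x" "h ** y = - y" "y ** h = y"
proof -
  show "h ** x = x" "x ** h = - x"
    using h_eigenvector[OF sl2(1) trace_hx_hy(1) hx] by simp_all
  have "commutator h y = - y + - y" using hy by simp
  from h_eigenvector[OF sl2(3) trace_hx_hy(2) this]
  show "h ** y = - y" "y ** h = y" by simp_all
qed

text \<open>
  The first two identities compare $x(hx)$ with $(xh)x$. For the others, left multiplication by $h$
  exchanges $xy + yx$ and $xy - yx = h$; the former is a scalar $t$ with $th = h$.
\<close>

lemma x_y_mult:
  "x ** x = 0" "y ** y = 0" "x ** y + y ** x = mat 1" "h ** h = mat 1"
proof -
  have "x ** (h ** x) = (x ** h) ** x" "y ** (h ** y) = (y ** h) ** y"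
    by (simp_all add: matrix_mul_assoc)
  then have "x ** x = - (x ** x)" "- (y ** y) = y ** y"
    by (simp_all only: h_mult matrix_ring_simps)
  then have "x ** x + x ** x = 0" "y ** y + y ** y = 0"
    by (metis add.right_inverse)+
  then show "x ** x = 0" "y ** y = 0" by (simp_all only: double_eq_0)
  have hxy: "h ** (x ** y) = x ** y" "h ** (y ** x) = - (y ** x)"
    using h_mult by (simp_all add: matrix_mul_assoc matrix_ring_simps)
  have h: "h = x ** y - y ** x" using xy by (simp add: commutator_def)
  define t where "t = trace (x ** y)"
  have t: "x ** y + y ** x = mat t"
    unfolding t_def by (rule sl2_anticommutator[OF sl2(1,3)])
  have "mat t ** h = h ** (x ** y + y ** x)" by (simp add: t mult_mat_eq)
  also have "\<dots> = h" by (simp only: matrix_ring_simps hxy h[symmetric] flip: diff_conv_add_uminus)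
  finally have "t * h $ i $ j = h $ i $ j" for i j by (metis mat_mult_nth)
  then have "t = 1" using h_neq_0 by (auto simp: mat2_eq_iff)
  with t show sum: "x ** y + y ** x = mat 1" by simp
  have "h ** h = h ** (x ** y - y ** x)" using h by simp
  also have "\<dots> = mat 1" by (simp add: matrix_ring_simps hxy sum)
  finally show "h ** h = mat 1" .
qed

lemma trace_products:
  "trace (x ** x) = 0" "trace (y ** y) = 0" "trace (h ** h) = 2"
  "trace (x ** y) = 1" "trace (y ** x) = 1"
  "trace (h ** x) = 0" "trace (x ** h) = 0" "trace (h ** y) = 0" "trace (y ** h) = 0"
proof -
  have "mat (trace (x ** y)) = (mat 1 :: 'r^2^2)"
    using sl2_anticommutator[OF sl2(1,3)] x_y_mult(3) by simp
  then show "trace (x ** y) = 1" by (simp add: mat2_eq_iff mat_def)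
  then show "trace (y ** x) = 1" by (metis trace_mul_sym)
qed (use trace_hx_hy trace_mul_sym[of x h] trace_mul_sym[of y h] in
      \<open>simp_all add: x_y_mult trace_def sum_2 mat_def\<close>)

text \<open>
  A matrix $W$ orthogonal to $x$, $h$, $y$ anticommutes with each of them. Anticommuting with $x$ and
  $y$ makes it commute with $h = xy - yx$ as well, so $2hW = 0$, and $h$ is invertible.
\<close>

lemma trace_form_nondegenerate:
  assumes "W \<in> sl2" "trace (W ** x) = 0" "trace (W ** h) = 0" "trace (W ** y) = 0"
  shows "W = 0"
proof -
  have m0: "mat 0 = (0 :: 'r^2^2)" by (simp add: mat2_eq_iff mat_def)
  have anti: "W ** x = - (x ** W)" "W ** h = - (h ** W)" "W ** y = - (y ** W)"
    using sl2_anticommutator[OF assms(1)] sl2 assms m0 by (simp_all add: eq_neg_iff_add_eq_0)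
  have "W ** (x ** y) = (x ** y) ** W" "W ** (y ** x) = (y ** x) ** W"
    by (simp_all only: matrix_mul_assoc anti matrix_ring_simps)
       (simp_all only: matrix_mul_assoc[symmetric] anti matrix_ring_simps minus_minus)
  then have "W ** h = h ** W"
    unfolding xy[symmetric] commutator_def by (simp only: matrix_ring_simps)
  with anti(2) have "h ** W + h ** W = 0" by (metis add.right_inverse)
  then have "h ** W = 0" by (simp only: double_eq_0)
  then have "h ** (h ** W) = 0" by (simp add: matrix_ring_simps)
  then show ?thesis by (simp add: matrix_mul_assoc x_y_mult)
qed

section \<open>The automorphism\<close>

text \<open>
  The entries are the coordinates of $Z$ in the basis $(x,h,y)$, read off by the trace form, in which
  $x$ and $y$ are dual to each other and $h$ is orthogonal to both with $\mathrm{tr}(h^2) = 2$.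
\<close>

definition to_standard :: "'r^2^2 \<Rightarrow> 'r^2^2" where
  "to_standard Z = mat2 (half * trace (Z ** h)) (trace (Z ** y))
     (trace (Z ** x)) (- (half * trace (Z ** h)))"

definition from_standard :: "'r^2^2 \<Rightarrow> 'r^2^2" where
  "from_standard Z = mat (Z$1$1) ** h + mat (Z$1$2) ** x + mat (Z$2$1) ** y"

lemma trace_linear:
  "trace ((A + B) ** C) = trace (A ** C) + trace (B ** C)"
  "trace ((A - B) ** C) = trace (A ** C) - trace (B ** C)"
  "trace ((mat c ** A) ** C) = c * trace (A ** C)" for A B C :: "'r^2^2"
  by (simp_all add: trace_def sum_2 mat2_mult_nth mat_def algebra_simps)

lemma to_standard_in_sl2: "to_standard Z \<in> sl2"
  by (simp add: to_standard_def sl2_iff)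

lemma from_standard_in_sl2: "from_standard Z \<in> sl2"
  using sl2 by (simp add: from_standard_def sl2_iff mat_mult_nth)

lemma to_from_standard:
  assumes "Z \<in> sl2"
  shows "to_standard (from_standard Z) = Z"
proof -
  have "half * (r * 2) = r" for r using half by (metis mult.assoc mult.commute mult_1)
  with assms show ?thesis
    by (simp add: to_standard_def from_standard_def trace_linear trace_products mat2_eq_iff sl2_iff)
qed

text \<open>
  That $x$, $h$, $y$ span all of $sl_2(R)$ cannot be had by counting dimensions over a ring. Instead,
  the difference of the two sides is orthogonal to the triple, so nondegeneracy applies.
\<close>

lemma from_to_standard:
  assumes "Z \<in> sl2"
  shows "from_standard (to_standard Z) = Z"
proof -
  let ?W = "Z - from_standard (to_standard Z)"
  have W: "?W \<in> sl2"
    using assms from_standard_in_sl2[of "to_standard Z"] by (simp add: sl2_iff)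
  have "half * trace ((A - B) ** h) = 0 \<and> trace ((A - B) ** x) = 0 \<and> trace ((A - B) ** y) = 0"
    if "to_standard A = to_standard B" for A B
    using that by (auto simp: to_standard_def mat2_eq_iff trace_linear)
  from this[of Z "from_standard (to_standard Z)"]
  have "half * trace (?W ** h) = 0" "trace (?W ** x) = 0" "trace (?W ** y) = 0"
    using to_from_standard[OF to_standard_in_sl2] by auto
  moreover have "half \<noteq> 0" using half by auto
  ultimately show ?thesis using trace_form_nondegenerate[OF W] by simp
qed

lemma commutator_bilinear:
  "commutator (A + B) C = commutator A C + commutator B C"
  "commutator C (A + B) = commutator C A + commutator C B"
  "commutator (mat c ** A) C = mat c ** commutator A C"
  "commutator C (mat c ** A) = mat c ** commutator C A"
  for A B C :: "'r^2^2"
  by (simp_all add: commutator_def mat2_eq_iff mat2_mult_nth mat_def algebra_simps)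

lemma commutators:
  "commutator x h = - (x + x)" "commutator y h = y + y" "commutator y x = - h"
  "commutator A A = 0"
  using hx hy xy by (simp_all add: commutator_def algebra_simps)

lemma from_standard_commutator:
  assumes "A \<in> sl2" "B \<in> sl2"
  shows "from_standard (commutator A B) = commutator (from_standard A) (from_standard B)"
proof -
  have "A $ 2 $ 2 = - A $ 1 $ 1" "B $ 2 $ 2 = - B $ 1 $ 1" using assms by (simp_all add: sl2_iff)
  then show ?thesis
    unfolding from_standard_def commutator_bilinear commutators hx hy xy
    by (simp add: mat2_eq_iff mat_mult_nth commutator_def mat2_mult_nth[of A B]
        mat2_mult_nth[of B A] algebra_simps)
qed

text \<open>
  Compatibility with brackets is transported from the inverse map, where it is a comparison of
  structure constants.
\<close>

lemma to_standard_commutator: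
  assumes "A \<in> sl2" "B \<in> sl2"
  shows "to_standard (commutator A B) = commutator (to_standard A) (to_standard B)"
proof -
  have "commutator A B = from_standard (commutator (to_standard A) (to_standard B))"
    by (simp add: from_standard_commutator to_standard_in_sl2 from_to_standard assms)
  moreover have "commutator (to_standard A) (to_standard B) \<in> sl2"
    by (simp add: sl2_iff commutator_def mat2_mult_nth algebra_simps)
  ultimately show ?thesis by (simp add: to_from_standard)
qed

lemma to_standard_triple:
  "to_standard x = mat2 0 1 0 0" "to_standard h = mat2 1 0 0 (- 1)"
  "to_standard y = mat2 0 0 1 0"
  using half by (simp_all add: to_standard_def trace_products mult.commute)

lemma to_standard_automorphism:
  fixes scal :: "'f::field \<Rightarrow> 'r \<Rightarrow> 'r"
  assumes "comm_unital_algebra scal"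
  shows "restrict to_standard sl2 \<in> Aut_sl2 scal"
proof -
  interpret comm_unital_algebra scal by fact
  have scale: "mat_scale scal c Z = mat (scal c 1) ** Z" for c and Z :: "'r^2^2"
    by (simp add: mat2_eq_iff mat_scale_def mat_mult_nth flip: scale_mult_left)
  have closed: "A + B \<in> sl2" "mat c ** A \<in> sl2" "commutator A B \<in> sl2"
    if "A \<in> sl2" "B \<in> sl2" for A B :: "'r^2^2" and c
    using that by (simp_all add: sl2_iff mat_def commutator_def mat2_mult_nth algebra_simps)
  have "to_standard (A + B) = to_standard A + to_standard B"
    "to_standard (mat c ** A) = mat c ** to_standard A" for A B c
    by (simp_all add: to_standard_def mat2_eq_iff trace_linear mat_mult_nth algebra_simps)
  moreover have "bij_betw to_standard sl2 sl2"
    by (rule bij_betw_byWitness[where f' = from_standard])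
       (auto simp: to_from_standard from_to_standard to_standard_in_sl2 from_standard_in_sl2)
  ultimately show ?thesis
    using to_standard_commutator unfolding lie_automorphisms_def by (auto simp: scale closed)
qed

section \<open>Conjugation over a unique factorization domain\<close>

lemma conjugate_to_standard:
  assumes "unique_factorization_domain TYPE('r)"
  obtains P where "P \<in> GL2" "P ** x ** matrix_inv P = mat2 0 1 0 0"
    "P ** h ** matrix_inv P = mat2 1 0 0 (- 1)" "P ** y ** matrix_inv P = mat2 0 0 1 0"
proof -
  define a b c where abc: "a = x$1$1" "b = x$1$2" "c = x$2$1"
  have x22: "x$2$2 = - a" using sl2(1) abc by (simp add: sl2_iff)
  have y22: "y$2$2 = - y$1$1" using sl2(3) by (simp add: sl2_iff)
  have "(x ** x)$1$1 = 0" by (simp add: x_y_mult)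
  then have sq: "b * (- c) = a\<^sup>2"
    by (simp add: mat2_mult_nth abc[symmetric] power2_eq_square add_eq_0_iff)
  have tr: "2 * a * y$1$1 + b * y$2$1 + c * y$1$2 = 1"
    using trace_products(4)
    by (simp add: trace_def sum_2 mat2_mult_nth x22 y22 abc[symmetric] algebra_simps)
  have cop: "d dvd 1" if "d dvd b" "d dvd - c" for d
  proof -
    \<comment> \<open>Modulo $d$ the trace relation reads $2ay_{11} = 1$, whereas $a^2 = 0$.\<close>
    have "1 - 2 * a * y$1$1 = b * y$2$1 + - c * - y$1$2"
      using tr by (simp add: algebra_simps)
    then have "d dvd 1 - 2 * a * y$1$1" using that by (metis dvd_add dvd_mult2)
    moreover have "d dvd a\<^sup>2" using sq that by (metis dvd_mult2)
    moreover have "1 = (1 - 2 * a * y$1$1) * (1 + 2 * a * y$1$1) + a\<^sup>2 * (2 * y$1$1)\<^sup>2"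
      by (simp add: power2_eq_square algebra_simps)
    ultimately show ?thesis by (metis dvd_add dvd_mult2)
  qed
  obtain u s t where u: "b = u * s\<^sup>2" "- c = u * t\<^sup>2" "a = u * s * t"
    using coprime_factors_of_square[OF assms sq cop] by blast
  have c: "c = - (u * t\<^sup>2)" using u(2) by (metis minus_minus)
  \<comment> \<open>The columns of $Q$ are the kernel vector $v = (s, -t)$ of $x$ and its image $yv$.\<close>
  define Q where "Q = mat2 s (y$1$1 * s - y$1$2 * t) (- t) (y$2$1 * s - y$2$2 * t)"
  have detQ: "det Q * u = 1"
    using tr c by (simp add: det_2 Q_def y22 u(1,3) power2_eq_square algebra_simps)
  then have "det Q dvd 1" by (metis dvd_triv_left)
  then have QG: "Q \<in> GL2" by (simp add: GL2_def)
  define P where "P = matrix_inv Q"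
  have PQ: "P ** Q = mat 1" "Q ** P = mat 1" using GL2_matrix_inv[OF QG] by (simp_all add: P_def)
  have "det P * det Q = 1" using PQ(1) by (metis det_I det_mul)
  then have PG: "P \<in> GL2" unfolding GL2_def by (auto simp: dvd_def intro: exI[of _ "det Q"])
  have inv: "matrix_inv P = Q"
    by (metis GL2_matrix_inv(2)[OF PG] PQ(1) matrix_mul_assoc matrix_mul_lid matrix_mul_rid)
  have xv: "a * s = b * t" "c * s = - (a * t)"
    using u by (simp_all add: power2_eq_square ac_simps)
      (metis add.inverse_inverse mult_minus_left mult.assoc mult.commute)
  have yy: "y$1$1 * y$1$1 + y$1$2 * y$2$1 = 0"
    using x_y_mult(2) by (simp add: mat2_eq_iff mat2_mult_nth)
  \<comment> \<open>The second column of $xQ$ is $xyv$; modulo $xv = 0$ it equals $\mathrm{tr}(xy)\,v = v$.\<close>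
  have "a * (y$1$1 * s - y$1$2 * t) + b * (y$2$1 * s + y$1$1 * t)
      = s * (2 * a * y$1$1 + b * y$2$1 + c * y$1$2)
        - y$1$1 * (a * s - b * t) - y$1$2 * (c * s + a * t)"
    "c * (y$1$1 * s - y$1$2 * t) - a * (y$2$1 * s + y$1$1 * t)
      = - t * (2 * a * y$1$1 + b * y$2$1 + c * y$1$2)
        + y$1$1 * (c * s + a * t) - y$2$1 * (a * s - b * t)"
    by (simp_all add: algebra_simps)
  then have xQ: "x ** Q = Q ** mat2 0 1 0 0"
    unfolding tr using xv by (simp add: mat2_eq_iff mat2_mult_nth Q_def x22 y22 abc[symmetric])
  have yv: "y$1$1 * (y$1$1 * s - y$1$2 * t) + y$1$2 * (y$2$1 * s + y$1$1 * t)
      = s * (y$1$1 * y$1$1 + y$1$2 * y$2$1)"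
    "y$2$1 * (y$1$1 * s - y$1$2 * t) - y$1$1 * (y$2$1 * s + y$1$1 * t)
      = - t * (y$1$1 * y$1$1 + y$1$2 * y$2$1)"
    by (simp_all add: algebra_simps)
  have yQ: "y ** Q = Q ** mat2 0 0 1 0"
    using yv yy by (simp add: mat2_eq_iff mat2_mult_nth Q_def y22)
  have "h ** Q = x ** (y ** Q) - y ** (x ** Q)"
    unfolding xy[symmetric] commutator_def by (simp only: matrix_ring_simps matrix_mul_assoc)
  also have "\<dots> = x ** Q ** mat2 0 0 1 0 - y ** Q ** mat2 0 1 0 0"
    by (simp only: xQ yQ matrix_mul_assoc)
  also have "\<dots> = Q ** mat2 1 0 0 (- 1)"
    unfolding xQ yQ by (simp add: mat2_eq_iff mat2_mult_nth)
  finally have "h ** Q = Q ** mat2 1 0 0 (- 1)" .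
  with xQ yQ
  have "P ** x ** Q = mat2 0 1 0 0" "P ** h ** Q = mat2 1 0 0 (- 1)"
    "P ** y ** Q = mat2 0 0 1 0"
    by (metis PQ(1) matrix_mul_assoc matrix_mul_lid)+
  with PG show ?thesis using that inv by simp
qed

end

section \<open>Standardizing a triple\<close>

theorem theorem6:
  fixes scal :: "'f::field \<Rightarrow> 'r::idom \<Rightarrow> 'r"
    and x h y :: "'r^2^2"
  assumes "CHAR('f) \<noteq> 2"
    and "comm_unital_algebra scal"
    and "x \<in> sl2" and "h \<in> sl2" and "y \<in> sl2"
    and "sl2_triple (mat_scale scal) commutator x h y"
  shows "(\<exists>\<tau>\<in>Aut_sl2 scal.
            \<tau> x = mat2 0 1 0 0 \<and> \<tau> h = mat2 1 0 0 (- 1) \<and> \<tau> y = mat2 0 0 1 0) \<and>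
         (unique_factorization_domain TYPE('r) \<longrightarrow>
           (\<exists>\<tau>\<in>Aut_sl2 scal \<inter> PGL2.
              \<tau> x = mat2 0 1 0 0 \<and> \<tau> h = mat2 1 0 0 (- 1) \<and> \<tau> y = mat2 0 0 1 0))"
proof -
  interpret comm_unital_algebra scal by fact
  have "(2::'f) \<noteq> 0"
  proof
    assume "(2::'f) = 0"
    then have "of_nat 2 = (0::'f)" by simp
    then have "CHAR('f) dvd 2" by (simp only: of_nat_eq_0_iff_char_dvd)
    then have "CHAR('f) = 1 \<or> CHAR('f) = 2" using two_is_prime_nat by (simp only: prime_nat_iff)
    with assms(1) show False by simp
  qed
  define half where "half = scal (inverse 2) 1"
  have "inverse 2 + inverse 2 = (1::'f)" using \<open>(2::'f) \<noteq> 0\<close> by (simp flip: mult_2)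
  then have half: "2 * half = 1"
    unfolding half_def mult_2 by (simp flip: scale_left_distrib)
  have two: "mat_scale scal 2 Z = Z + Z" "mat_scale scal (- 2) Z = - (Z + Z)" for Z :: "'r^2^2"
  proof -
    have "scal 2 r = r + r" for r :: 'r
      using scale_left_distrib[of 1 1 r] by simp
    then show "mat_scale scal 2 Z = Z + Z" "mat_scale scal (- 2) Z = - (Z + Z)"
      by (simp_all add: mat2_eq_iff mat_scale_def)
  qed
  interpret matrix_sl2_triple x h y half
    by unfold_locales (use assms half in \<open>simp_all add: sl2_triple_def two\<close>)
  show ?thesis
  proof (intro conjI impI)
    show "\<exists>\<tau>\<in>Aut_sl2 scal. \<tau> x = mat2 0 1 0 0 \<and> \<tau> h = mat2 1 0 0 (- 1) \<and> \<tau> y = mat2 0 0 1 0"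
      using to_standard_automorphism[OF assms(2)] to_standard_triple assms(3-5)
      by (intro bexI[of _ "restrict to_standard sl2"]) simp_all
  next
    assume "unique_factorization_domain TYPE('r)"
    then obtain P where P: "P \<in> GL2" "P ** x ** matrix_inv P = mat2 0 1 0 0"
      "P ** h ** matrix_inv P = mat2 1 0 0 (- 1)" "P ** y ** matrix_inv P = mat2 0 0 1 0"
      using conjugate_to_standard by blast
    let ?\<tau> = "restrict (\<lambda>Z. P ** Z ** matrix_inv P) sl2"
    have "?\<tau> \<in> PGL2" using P(1) by (auto simp: PGL2_def)
    then show "\<exists>\<tau>\<in>Aut_sl2 scal \<inter> PGL2.
        \<tau> x = mat2 0 1 0 0 \<and> \<tau> h = mat2 1 0 0 (- 1) \<and> \<tau> y = mat2 0 0 1 0"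
      using P assms(3-5) PGL2_subset_Aut by (intro bexI[of _ ?\<tau>]) auto
  qed
qed

end
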